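(* Let $V$ be a random variable on $[0,1]$. Suppose that there exist an integer $n\ge1$ and real numbers $0\le v_0<1$, $\alpha>0$, $\varepsilon_i$ and $\gamma_i$ ($0\le i\le n$), such that $$0=\varepsilon_0<\varepsilon_1<\dots<\varepsilon_{n-1}\le1<\varepsilon_n,$$ and, for every $v_0\le v\le1$, $$\Big|\mathbb P(V\ge v)-\sum_{i=0}^{n-1}\gamma_i(1-v)^{\alpha+\varepsilon_i}\Big|\le\gamma_n(1-v)^{\alpha+\varepsilon_n}.$$ Then there exists a finite $\theta(\gamma)$, which depends continuously on $\gamma=(\gamma_0,\dots,\gamma_n)$, such that for every $t\ge\theta(\gamma)$, $$2t\,R_t\ge\alpha .$$
   Context: For every nonnegative real $t$ and every $[0,1]$-valued random variable $V$, $M_t=\mathbb E(V^t)$ and $$R_t=1-\frac{M_{t+1}}{M_t}=\frac{\mathbb E(V^t(1-V))}{\mathbb E(V^t)} .$$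
   Formalization: The leading coefficient γ_0 is assumed nonzero, so that α is the leading exponent of the tail; θ is continuous on the vectors γ with γ_0 ≠ 0. With γ_0 = 0 the claim fails, e.g. n = 1, γ = (0,1), V = 1−δ with probability δ^(α+ε_1) and V = 0 otherwise. *)

theory Defs
  imports "HOL-Probability.Probability"
begin

text \<open>
  The power \<open>V\<^sup>t\<close> uses the convention that zero to the power zero is one, whereas
  \<open>0 powr 0 = 0\<close> in the library; hence the case distinction.
\<close>

definition moment :: "'a measure \<Rightarrow> ('a \<Rightarrow> real) \<Rightarrow> real \<Rightarrow> real" where
  "moment M V t = (\<integral>\<omega>. (if t = 0 then 1 else V \<omega> powr t) \<partial>M)"

definition R_fun :: "'a measure \<Rightarrow> ('a \<Rightarrow> real) \<Rightarrow> real \<Rightarrow> real" where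
  "R_fun M V t = 1 - moment M V (t + 1) / moment M V t"

definition unit_random_variable :: "'a measure \<Rightarrow> ('a \<Rightarrow> real) \<Rightarrow> bool" where
  "unit_random_variable M V \<longleftrightarrow>
     prob_space M \<and> V \<in> borel_measurable M \<and> (\<forall>\<omega>\<in>space M. 0 \<le> V \<omega> \<and> V \<omega> \<le> 1)"

definition tail_expansion ::
  "nat \<Rightarrow> real \<Rightarrow> real \<Rightarrow> (nat \<Rightarrow> real) \<Rightarrow> (nat \<Rightarrow> real) \<Rightarrow> 'a measure \<Rightarrow> ('a \<Rightarrow> real) \<Rightarrow> bool" where
  "tail_expansion n v0 \<alpha> \<epsilon> \<gamma> M V \<longleftrightarrow>
     (\<forall>v. v0 \<le> v \<and> v \<le> 1 \<longrightarrow>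
        \<bar>measure M {\<omega>\<in>space M. v \<le> V \<omega>} - (\<Sum>i<n. \<gamma> i * (1 - v) powr (\<alpha> + \<epsilon> i))\<bar>
          \<le> \<gamma> n * (1 - v) powr (\<alpha> + \<epsilon> n))"

text \<open>
  The space of coefficient vectors \<open>(\<gamma> 0, \<dots>, \<gamma> n)\<close>, with the topology of Euclidean
  \<open>(n+1)\<close>-space; in the library encoding \<open>\<gamma> i = 0\<close> for \<open>i > n\<close>.

  The leading coefficient is required to be nonzero, so that \<open>\<alpha>\<close> really is the leading exponent
  of the tail. This cannot be dropped: if, for example, \<open>n = 1\<close> and \<open>\<gamma> = (0, 1)\<close>, the variable
  equal to \<open>1 - \<delta>\<close> with probability \<open>\<delta> powr (\<alpha> + \<epsilon> 1)\<close> and to \<open>0\<close> otherwise satisfies the tail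
  bound for every small \<open>\<delta> > 0\<close>, and it has \<open>R_t = \<delta>\<close> for \<open>t > 0\<close>.
\<close>

definition coeff_space :: "nat \<Rightarrow> (nat \<Rightarrow> real) topology" where
  "coeff_space n = subtopology (Euclidean_space (Suc n)) {\<gamma>. \<gamma> 0 \<noteq> 0}"

end

theory Submission
  imports Defs
begin

text \<open>
  Write \<open>F v\<close> for \<open>P (V \<ge> v)\<close>. If \<open>F v\<close> behaves like \<open>\<gamma> 0 * (1 - v) powr \<alpha>\<close> near \<open>v = 1\<close>, with
  \<open>\<gamma> 0 > 0\<close>, then \<open>t * R_t\<close> tends to \<open>\<alpha>\<close>, so the bound \<open>\<alpha> / 2\<close> holds for large \<open>t\<close> with a factor two to spare. The
  lower order terms of the expansion are absorbed in an error of order \<open>(1 - v) powr (\<alpha> + d)\<close> with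
  \<open>d = min 1 (\<epsilon> 1)\<close>, where \<open>d \<le> 1\<close> makes \<open>(1 - v) powr d\<close> concave. What has to be done is to make the
  asymptotic argument explicit enough for the threshold to be a continuous function of \<open>\<gamma>\<close>.

  The error bound can be assumed on the whole of \<open>[0, 1]\<close>: away from \<open>1\<close> the quantities compared
  are bounded and \<open>1 - v\<close> is not small, so it suffices to enlarge the constant
  (\<open>tail_expansion_leading_term\<close>). As a result no exponentially small remainders occur, and every
  integral below is a Beta function. Since \<open>F\<close> is nonnegative, the bound also forces \<open>\<gamma> 0 \<ge> 0\<close>
  (\<open>leading_coeff_nonneg\<close>), hence \<open>\<gamma> 0 > 0\<close> on the coefficient space.

  For \<open>t > 0\<close>, with \<open>M_t\<close> the moment of order \<open>t\<close>, the claim amounts to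
  \<open>I = M_t - M_(t+1) - (\<alpha> / (2 * t)) * M_t \<ge> 0\<close>. The layer cake formula
  (\<open>expectation_powr_eq_integral_tail\<close>) gives
  \<open>I = \<integral> v powr (t - 1) * ((t + 1) * (1 - v) - (\<alpha> / 2 + 1)) * F v dv\<close> over \<open>[0, 1]\<close>. The leading
  term contributes at least \<open>\<gamma> 0 * \<alpha> / 6 * Beta t (\<alpha> + 1)\<close> once \<open>t \<ge> 2 * (\<alpha> + 1)\<close>. In the error term
  the kernel must be replaced by its absolute value, but both of its summands are of the same size
  on the scale \<open>1 - v \<sim> 1 / t\<close>, so the error is at most a constant times
  \<open>Beta t (\<alpha> + 1 + d)\<close>, which is smaller than \<open>Beta t (\<alpha> + 1)\<close> by a factor of order
  \<open>t powr (- d)\<close> (\<open>Beta_add_right_le\<close>). Comparing the two contributions yields the threshold.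
\<close>

section \<open>The layer cake formula for moments\<close>

text \<open>
  Tonelli's theorem for \<open>V powr s = \<integral> s * v powr (s - 1) dv\<close> over \<open>0 \<le> v \<le> V\<close>. The conclusion is phrased
  with a gauge integral, so that the Beta integral can be used directly against it.
\<close>

lemma (in prob_space) expectation_powr_eq_integral_tail:
  fixes V :: "'a \<Rightarrow> real"
  assumes V [measurable]: "V \<in> borel_measurable M"
    and V01: "\<And>\<omega>. \<omega> \<in> space M \<Longrightarrow> 0 \<le> V \<omega> \<and> V \<omega> \<le> 1"
    and s: "0 < s"
  shows "((\<lambda>v. s * v powr (s - 1) * prob {\<omega> \<in> space M. v \<le> V \<omega>})
            has_integral expectation (\<lambda>\<omega>. V \<omega> powr s)) {0..1}"
proof -
  interpret P: pair_sigma_finite M lborel ..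
  let ?F = "\<lambda>v. prob {\<omega> \<in> space M. v \<le> V \<omega>}"
  let ?k = "\<lambda>v::real. s * v powr (s - 1) * indicator {0..1} v"
  have k_nonneg: "0 \<le> ?k v" for v
    using s by simp
  have F_meas [measurable]: "?F \<in> borel_measurable borel"
  proof -
    have "mono (\<lambda>v. - ?F v)"
      by (intro monoI le_imp_neg_le finite_measure_mono) auto
    then have "(\<lambda>v. - (- ?F v)) \<in> borel_measurable borel"
      by (intro borel_measurable_uminus borel_measurable_mono)
    then show ?thesis by simp
  qed
  have inner: "(\<integral>\<^sup>+ v. ennreal (?k v * indicator {..V \<omega>} v) \<partial>lborel) = ennreal (V \<omega> powr s)"
    if w: "\<omega> \<in> space M" for \<omega>
  proof -
    have "((\<lambda>v. v powr (s - 1)) has_integral (V \<omega> powr s / s)) {0..V \<omega>}"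
      using has_integral_powr_from_0 [of "s - 1" "V \<omega>"] s V01 [OF w] by simp
    from has_integral_mult_right [OF this, of s]
    have "((\<lambda>v. s * v powr (s - 1)) has_integral V \<omega> powr s) {0..V \<omega>}"
      using s by simp
    then have "(\<integral>\<^sup>+ v. ennreal (s * v powr (s - 1)) * indicator {0..V \<omega>} v \<partial>lborel)
                 = ennreal (V \<omega> powr s)"
      using s by (intro nn_integral_has_integral_lebesgue') auto
    moreover have "ennreal (?k v * indicator {..V \<omega>} v)
                     = ennreal (s * v powr (s - 1)) * indicator {0..V \<omega>} v" for v
      using V01 [OF w] by (auto simp: indicator_def)
    ultimately show ?thesis by simp
  qed
  have outer: "(\<integral>\<^sup>+ \<omega>. ennreal (?k v * indicator {..V \<omega>} v) \<partial>M) = ennreal (?k v * ?F v)" for v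
  proof -
    have "(\<integral>\<^sup>+ \<omega>. ennreal (?k v * indicator {..V \<omega>} v) \<partial>M)
            = (\<integral>\<^sup>+ \<omega>. ennreal (?k v) * indicator {\<omega> \<in> space M. v \<le> V \<omega>} \<omega> \<partial>M)"
      by (intro nn_integral_cong) (auto simp: indicator_def)
    also have "\<dots> = ennreal (?k v) * emeasure M {\<omega> \<in> space M. v \<le> V \<omega>}"
      by (intro nn_integral_cmult_indicator) measurable
    also have "\<dots> = ennreal (?k v * ?F v)"
      using k_nonneg by (simp add: emeasure_eq_measure ennreal_mult')
    finally show ?thesis .
  qed
  have "(\<integral>\<^sup>+ v. (\<integral>\<^sup>+ \<omega>. ennreal (?k v * indicator {..V \<omega>} v) \<partial>M) \<partial>lborel)
          = (\<integral>\<^sup>+ \<omega>. (\<integral>\<^sup>+ v. ennreal (?k v * indicator {..V \<omega>} v) \<partial>lborel) \<partial>M)"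
    by (rule P.Fubini') (unfold indicator_def atMost_iff, measurable)
  then have "(\<integral>\<^sup>+ v. ennreal (?k v * ?F v) \<partial>lborel) = (\<integral>\<^sup>+ \<omega>. ennreal (V \<omega> powr s) \<partial>M)"
    using inner by (simp add: outer cong: nn_integral_cong)
  also have "\<dots> = ennreal (expectation (\<lambda>\<omega>. V \<omega> powr s))"
  proof (rule nn_integral_eq_integral)
    show "integrable M (\<lambda>\<omega>. V \<omega> powr s)"
      using V01 s by (intro integrable_const_bound [where B = 1]) (auto intro!: powr_le1)
  qed auto
  finally have "((\<lambda>v. ?k v * ?F v) has_integral expectation (\<lambda>\<omega>. V \<omega> powr s)) UNIV"
    using k_nonneg by (intro nn_integral_has_integral) auto
  moreover have "(\<lambda>v. ?k v * ?F v)
      = (\<lambda>v. if v \<in> {0..1} then s * v powr (s - 1) * ?F v else 0)"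
    by (auto simp: indicator_def)
  ultimately show ?thesis
    by (simp only: has_integral_restrict_UNIV)
qed

section \<open>Powers and the Beta function\<close>

lemma le_powr_of_root_le:
  fixes x y d :: real
  assumes "0 < x" "0 < d" "x powr (1 / d) \<le> y"
  shows "x \<le> y powr d"
proof -
  have "x = (x powr (1 / d)) powr d"
    using assms by (simp add: powr_powr)
  also have "\<dots> \<le> y powr d"
    using assms by (intro powr_mono2) auto
  finally show ?thesis .
qed

text \<open>
  A linear majorant of a concave power. It turns the integral of \<open>(1 - v) powr d\<close>
  against a weight into integrals of \<open>1\<close> and \<open>1 - v\<close>, and the
  parameter \<open>l\<close> is to be chosen as the scale at which the weight concentrates.
\<close>

lemma powr_le_linear:
  fixes x l d :: real
  assumes "0 \<le> x" "0 < l" "0 \<le> d" "d \<le> 1"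
  shows "x powr d \<le> l powr d + l powr (d - 1) * x"
proof (cases "x \<le> l")
  case True
  then show ?thesis using assms by (smt (verit) mult_nonneg_nonneg powr_ge_zero powr_mono2)
next
  case False
  then have "x powr (d - 1) \<le> l powr (d - 1)"
    using assms by (intro powr_mono2') auto
  then have "x powr (d - 1) * x \<le> l powr (d - 1) * x"
    using assms by (intro mult_right_mono) auto
  moreover have "x powr (d - 1) * x = x powr d"
    using False assms by (simp add: powr_diff)
  ultimately show ?thesis by (smt (verit) powr_ge_zero)
qed

lemma Beta_plus1_right_pos:
  fixes x y :: real
  assumes "0 < x" "0 < y"
  shows "Beta x (y + 1) = y / (x + y) * Beta x y"
proof -
  have "(x + y) * Beta x (y + 1) = y * Beta x y"
    using assms by (intro Beta_plus1_right) (auto dest: nonpos_Ints_nonpos)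
  then show ?thesis
    using assms by (simp add: field_simps)
qed

text \<open>
  The density proportional to \<open>v powr (t - 1) * (1 - v) powr (p - 1)\<close> concentrates at distance about
  \<open>1 / t\<close> from \<open>1\<close>, so an additional factor \<open>(1 - v) powr d\<close> costs about \<open>t powr (- d)\<close>. Majorising that
  factor linearly reduces the estimate to the recurrence of the Beta function in its second
  argument.
\<close>

lemma Beta_add_right_le:
  fixes t p d :: real
  assumes t: "0 < t" and p: "1 < p" and d: "0 < d" "d \<le> 1"
  shows "Beta t (p + d) \<le> (p + 1) * t powr (- d) * Beta t p"
proof -
  \<comment> \<open>the scale at which the two terms of the linear majorant have the same order\<close>
  let ?l = "1 / t"
  have B0: "0 \<le> Beta t p"
    using t p by (simp add: Beta_def)
  have "((\<lambda>v. ?l powr d * (v powr (t - 1) * (1 - v) powr (p - 1))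
             + ?l powr (d - 1) * (v powr (t - 1) * (1 - v) powr (p + 1 - 1)))
         has_integral (?l powr d * Beta t p + ?l powr (d - 1) * Beta t (p + 1))) {0..1}"
    using t p by (intro has_integral_add has_integral_mult_right has_integral_Beta_real) auto
  moreover have "((\<lambda>v. v powr (t - 1) * (1 - v) powr (p + d - 1)) has_integral Beta t (p + d)) {0..1}"
    using t p d by (intro has_integral_Beta_real) auto
  moreover have "v powr (t - 1) * (1 - v) powr (p + d - 1)
      \<le> ?l powr d * (v powr (t - 1) * (1 - v) powr (p - 1))
             + ?l powr (d - 1) * (v powr (t - 1) * (1 - v) powr (p + 1 - 1))"
    if "v \<in> {0..1}" for v
  proof -
    have 1: "(1 - v) powr (p + d - 1) = (1 - v) powr (p - 1) * (1 - v) powr d"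
      by (simp add: powr_add [symmetric] algebra_simps)
    have 2: "(1 - v) powr (p + 1 - 1) = (1 - v) powr (p - 1) * (1 - v)"
      using that p by (cases "v = 1") (auto simp: powr_diff)
    have "(1 - v) powr d \<le> ?l powr d + ?l powr (d - 1) * (1 - v)"
      using that t d by (intro powr_le_linear) auto
    from mult_left_mono [OF this, of "v powr (t - 1) * (1 - v) powr (p - 1)"]
    show ?thesis unfolding 1 2 by (simp add: algebra_simps)
  qed
  ultimately have "Beta t (p + d) \<le> ?l powr d * Beta t p + ?l powr (d - 1) * Beta t (p + 1)"
    by (meson has_integral_le)
  also have "Beta t (p + 1) \<le> p / t * Beta t p"
  proof -
    have "Beta t (p + 1) = p / (t + p) * Beta t p"
      using t p by (intro Beta_plus1_right_pos) auto
    also have "\<dots> \<le> p / t * Beta t p"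
      using t p B0 by (intro mult_right_mono divide_left_mono) auto
    finally show ?thesis .
  qed
  also have "?l powr d * Beta t p + ?l powr (d - 1) * (p / t * Beta t p)
      = (p + 1) * t powr (- d) * Beta t p"
    using t by (simp add: powr_divide powr_minus powr_diff field_simps)
  finally show ?thesis by (simp add: mult_left_mono)
qed

section \<open>The moment gap in terms of the leading tail behaviour\<close>

text \<open>
  The kernel changes sign, so the lower bound on \<open>F\<close> may be used only with the absolute value
  of the kernel in front of the error term. The leading term is computed exactly:
  the integral of the kernel against \<open>(1 - v) powr a\<close> equals
  \<open>(t * a / (t + a + 1) - a / 2) * Beta t (a + 1)\<close>, where the first summand is close to \<open>a\<close>.
\<close>

lemma moment_gap_lower_bound:
  fixes F :: "real \<Rightarrow> real" and t a d g H I :: real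
  assumes t: "2 * (a + 1) \<le> t" and a: "0 < a" and d: "0 < d" "d \<le> 1" and g: "0 < g" and H: "0 \<le> H"
    and F: "\<And>v. 0 \<le> v \<Longrightarrow> v \<le> 1 \<Longrightarrow> \<bar>F v - g * (1 - v) powr a\<bar> \<le> H * (1 - v) powr (a + d)"
    and I: "((\<lambda>v. v powr (t - 1) * ((t + 1) * (1 - v) - (a / 2 + 1)) * F v) has_integral I) {0..1}"
  shows "Beta t (a + 1) * (g * a / 6 - H * (2 * a + 3) * (a + 2) * t powr (- d)) \<le> I"
proof -
  let ?B = "\<lambda>p. Beta t p" and ?e = "\<lambda>p v. v powr (t - 1) * (1 - v) powr (p - 1) :: real"
  have t0: "0 < t" using t a by (simp add: algebra_simps)
  have Bint: "(?e p has_integral ?B p) {0..1}" if "0 < p" for p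
    using t0 that by (rule has_integral_Beta_real)
  have Bpos: "0 < ?B p" if "0 < p" for p
    using t0 that by (simp add: Beta_def)
  have Brec: "?B (p + 1) = p / (t + p) * ?B p" if "0 < p" for p
    using t0 that by (rule Beta_plus1_right_pos)
  let ?J = "g * ((t + 1) * ?B (a + 2) - (a / 2 + 1) * ?B (a + 1))
     - H * ((t + 1) * ?B (a + d + 2) + (a / 2 + 1) * ?B (a + d + 1))"
  have "((\<lambda>v. g * ((t + 1) * ?e (a + 2) v - (a / 2 + 1) * ?e (a + 1) v)
     - H * ((t + 1) * ?e (a + d + 2) v + (a / 2 + 1) * ?e (a + d + 1) v)) has_integral ?J) {0..1}"
    using a d by (intro has_integral_diff has_integral_add has_integral_mult_right Bint) auto
  then have "?J \<le> I"
  proof (rule has_integral_le [OF _ I])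
    fix v :: real assume v: "v \<in> {0..1}"
    let ?q = "v powr (t - 1)" and ?w = "(t + 1) * (1 - v) - (a / 2 + 1)"
      and ?W = "(t + 1) * (1 - v) + (a / 2 + 1)"
    have p1: "(1 - v) powr (p + 2 - 1) = (1 - v) * (1 - v) powr p" if "0 < p" for p
      using v that by (cases "v = 1") (auto simp: powr_add)
    have w: "\<bar>?w\<bar> \<le> ?W"
    proof -
      have "0 \<le> (t + 1) * (1 - v)" using v t0 by simp
      then show ?thesis using a by linarith
    qed
    have "\<bar>?w * (F v - g * (1 - v) powr a)\<bar> \<le> ?W * (H * (1 - v) powr (a + d))"
      unfolding abs_mult using w F v by (intro mult_mono) auto
    then have "g * (?w * (1 - v) powr a) - H * (?W * (1 - v) powr (a + d)) \<le> ?w * F v"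
      unfolding abs_le_iff by (simp add: algebra_simps)
    from mult_left_mono [OF this, of ?q]
    show "g * ((t + 1) * ?e (a + 2) v - (a / 2 + 1) * ?e (a + 1) v)
     - H * ((t + 1) * ?e (a + d + 2) v + (a / 2 + 1) * ?e (a + d + 1) v) \<le> ?q * ?w * F v"
      unfolding p1 [OF a] p1 [OF add_pos_pos, OF a d(1)] by (simp add: algebra_simps)
  qed
  moreover have "a / 6 * ?B (a + 1) \<le> (t + 1) * ?B (a + 2) - (a / 2 + 1) * ?B (a + 1)"
  proof -
    have eq: "(t + 1) * ?B (a + 2) - (a / 2 + 1) * ?B (a + 1)
        = (t * a / (t + a + 1) - a / 2) * ?B (a + 1)"
    proof -
      have "?B (a + 2) = (a + 1) / (t + a + 1) * ?B (a + 1)"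
        using Brec [of "a + 1"] a by (simp add: add.assoc)
      moreover have "t + a + 1 \<noteq> 0" using a t0 by simp
      ultimately show ?thesis
        by (simp only:) (simp add: divide_simps, simp add: algebra_simps)
    qed
    \<comment> \<open>this is where \<open>t \<ge> 2 * (a + 1)\<close> enters: \<open>2 / 3 - 1 / 2 = 1 / 6\<close>\<close>
    have "2 / 3 * a \<le> t * a / (t + a + 1)"
      using t a mult_right_mono [OF t, of a] by (simp add: field_simps)
    then have "a / 6 \<le> t * a / (t + a + 1) - a / 2" by linarith
    then show ?thesis
      unfolding eq using Bpos [of "a + 1"] a by (intro mult_right_mono) auto
  qed
  moreover have "(t + 1) * ?B (a + d + 2) + (a / 2 + 1) * ?B (a + d + 1)
      \<le> (2 * a + 3) * ?B (a + d + 1)"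
  proof -
    have "(t + 1) * ?B (a + d + 2) = (t + 1) * (a + d + 1) / (t + a + d + 1) * ?B (a + d + 1)"
      using Brec [of "a + d + 1"] a d t0 by (simp add: algebra_simps)
    also have "\<dots> \<le> (a + d + 1) * ?B (a + d + 1)"
    proof (intro mult_right_mono)
      show "(t + 1) * (a + d + 1) / (t + a + d + 1) \<le> a + d + 1"
        using a d t0 by (simp add: divide_le_eq)
    qed (use Bpos [of "a + d + 1"] a d in auto)
    finally have "(t + 1) * ?B (a + d + 2) + (a / 2 + 1) * ?B (a + d + 1)
        \<le> (a + d + 1 + (a / 2 + 1)) * ?B (a + d + 1)"
      by (simp add: algebra_simps)
    also have "\<dots> \<le> (2 * a + 3) * ?B (a + d + 1)"
      using Bpos [of "a + d + 1"] a d by (intro mult_right_mono) auto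
    finally show ?thesis .
  qed
  moreover have "?B (a + d + 1) \<le> (a + 2) * t powr (- d) * ?B (a + 1)"
    using Beta_add_right_le [of t "a + 1" d] t0 a d by (simp add: algebra_simps)
  ultimately have J: "?J \<le> I"
      and 1: "g * (a / 6 * ?B (a + 1)) \<le> g * ((t + 1) * ?B (a + 2) - (a / 2 + 1) * ?B (a + 1))"
      and 2: "H * ((t + 1) * ?B (a + d + 2) + (a / 2 + 1) * ?B (a + d + 1))
           \<le> H * ((2 * a + 3) * ?B (a + d + 1))"
      and 3: "H * (2 * a + 3) * ?B (a + d + 1) \<le> H * (2 * a + 3) * ((a + 2) * t powr (- d) * ?B (a + 1))"
    using g H a by (auto intro!: mult_left_mono)
  have "?B (a + 1) * (g * a / 6 - H * (2 * a + 3) * (a + 2) * t powr (- d))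
      = g * (a / 6 * ?B (a + 1)) - H * (2 * a + 3) * ((a + 2) * t powr (- d) * ?B (a + 1))"
    by (simp add: algebra_simps)
  with J 1 2 3 show ?thesis by linarith
qed

section \<open>Reduction of the expansion to its leading term\<close>

text \<open>
  The sum accounts for the lower order terms on \<open>[v0, 1]\<close>. The quotient makes the error bound trivial
  on \<open>[0, v0]\<close>, and it keeps the coefficient positive even if all \<open>\<gamma> i\<close> vanish.
\<close>

definition error_coeff :: "nat \<Rightarrow> real \<Rightarrow> real \<Rightarrow> (nat \<Rightarrow> real) \<Rightarrow> real" where
  "error_coeff n v0 p \<gamma> = (\<Sum>i=1..n. \<bar>\<gamma> i\<bar>) + (1 + \<bar>\<gamma> 0\<bar>) / (1 - v0) powr p"

lemma error_coeff_pos: "v0 < 1 \<Longrightarrow> 0 < error_coeff n v0 p \<gamma>"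
  unfolding error_coeff_def by (intro add_nonneg_pos sum_nonneg divide_pos_pos add_pos_nonneg) auto

lemma tail_expansion_leading_term:
  fixes V :: "'a \<Rightarrow> real"
  assumes M: "prob_space M" and n: "1 \<le> n" and v0: "0 \<le> v0" "v0 < 1" and a: "0 < \<alpha>" and d: "0 < d"
    and e0: "\<epsilon> 0 = 0" and e: "\<And>i. 1 \<le> i \<Longrightarrow> i \<le> n \<Longrightarrow> d \<le> \<epsilon> i"
    and T: "tail_expansion n v0 \<alpha> \<epsilon> \<gamma> M V" and v: "0 \<le> v" "v \<le> 1"
  shows "\<bar>measure M {\<omega> \<in> space M. v \<le> V \<omega>} - \<gamma> 0 * (1 - v) powr \<alpha>\<bar>
           \<le> error_coeff n v0 (\<alpha> + d) \<gamma> * (1 - v) powr (\<alpha> + d)"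
proof (cases "v0 \<le> v")
  case True
  let ?F = "measure M {\<omega> \<in> space M. v \<le> V \<omega>}"
  let ?S = "\<Sum>i=1..<n. \<gamma> i * (1 - v) powr (\<alpha> + \<epsilon> i)"
  have split: "(\<Sum>i<n. \<gamma> i * (1 - v) powr (\<alpha> + \<epsilon> i)) = \<gamma> 0 * (1 - v) powr \<alpha> + ?S"
    using n e0 by (simp add: lessThan_atLeast0 sum.atLeast_Suc_lessThan)
  have le: "\<bar>\<gamma> i * (1 - v) powr (\<alpha> + \<epsilon> i)\<bar> \<le> \<bar>\<gamma> i\<bar> * (1 - v) powr (\<alpha> + d)"
    if "1 \<le> i" "i \<le> n" for i
    unfolding abs_mult using e [OF that] v by (intro mult_mono) (auto intro!: powr_mono')
  have "\<bar>?F - (\<gamma> 0 * (1 - v) powr \<alpha> + ?S)\<bar> \<le> \<gamma> n * (1 - v) powr (\<alpha> + \<epsilon> n)"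
    using T [unfolded tail_expansion_def, rule_format, of v] True v by (simp only: split)
  also have "\<dots> \<le> \<bar>\<gamma> n\<bar> * (1 - v) powr (\<alpha> + d)"
    using le [of n] n by linarith
  finally have 1: "\<bar>?F - (\<gamma> 0 * (1 - v) powr \<alpha> + ?S)\<bar> \<le> \<bar>\<gamma> n\<bar> * (1 - v) powr (\<alpha> + d)" .
  have 2: "\<bar>?S\<bar> \<le> (\<Sum>i=1..<n. \<bar>\<gamma> i\<bar> * (1 - v) powr (\<alpha> + d))"
    by (rule order_trans [OF sum_abs]) (auto intro!: sum_mono le)
  have 3: "(\<Sum>i=1..<n. \<bar>\<gamma> i\<bar> * (1 - v) powr (\<alpha> + d)) + \<bar>\<gamma> n\<bar> * (1 - v) powr (\<alpha> + d)
      = (\<Sum>i=1..n. \<bar>\<gamma> i\<bar>) * (1 - v) powr (\<alpha> + d)"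
    using n by (simp add: sum.last_plus sum_distrib_right distrib_right)
  have "(\<Sum>i=1..n. \<bar>\<gamma> i\<bar>) * (1 - v) powr (\<alpha> + d)
      \<le> error_coeff n v0 (\<alpha> + d) \<gamma> * (1 - v) powr (\<alpha> + d)"
    unfolding error_coeff_def by (intro mult_right_mono) auto
  with 1 2 3 show ?thesis by linarith
next
  case False
  interpret prob_space M by (rule M)
  have "(1 - v) powr \<alpha> \<le> 1" using v a by (intro powr_le1) auto
  then have "\<bar>\<gamma> 0 * (1 - v) powr \<alpha>\<bar> \<le> \<bar>\<gamma> 0\<bar> * 1"
    unfolding abs_mult by (intro mult_left_mono) auto
  moreover have "0 \<le> prob {\<omega> \<in> space M. v \<le> V \<omega>}" "prob {\<omega> \<in> space M. v \<le> V \<omega>} \<le> 1" by auto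
  ultimately have "\<bar>prob {\<omega> \<in> space M. v \<le> V \<omega>} - \<gamma> 0 * (1 - v) powr \<alpha>\<bar> \<le> 1 + \<bar>\<gamma> 0\<bar>"
    by linarith
  also have "\<dots> \<le> (1 + \<bar>\<gamma> 0\<bar>) / (1 - v0) powr (\<alpha> + d) * (1 - v) powr (\<alpha> + d)"
  proof -
    have "(1 - v0) powr (\<alpha> + d) \<le> (1 - v) powr (\<alpha> + d)"
      using False v0 v a d by (intro powr_mono2) auto
    then show ?thesis using v0 by (simp add: pos_le_divide_eq mult_left_mono)
  qed
  also have "\<dots> \<le> error_coeff n v0 (\<alpha> + d) \<gamma> * (1 - v) powr (\<alpha> + d)"
    unfolding error_coeff_def by (intro mult_right_mono) (auto intro!: sum_nonneg)
  finally show ?thesis .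
qed

text \<open>
  Divide \<open>0 \<le> F v \<le> g * (1 - v) powr a + H * (1 - v) powr (a + d)\<close> by \<open>(1 - v) powr a\<close> and
  let \<open>v\<close> tend to \<open>1\<close>.
\<close>

lemma leading_coeff_nonneg:
  fixes F :: "real \<Rightarrow> real"
  assumes d: "0 < d"
    and F0: "\<And>v. 0 \<le> F v"
    and F: "\<And>v. 0 \<le> v \<Longrightarrow> v \<le> 1 \<Longrightarrow> \<bar>F v - g * (1 - v) powr a\<bar> \<le> H * (1 - v) powr (a + d)"
  shows "0 \<le> g"
proof -
  have "((\<lambda>x. - (H * x powr d)) \<longlongrightarrow> - (H * 0)) (at_right (0::real))"
  proof (intro tendsto_intros)
    have "((\<lambda>x. x powr d) \<longlongrightarrow> 0 powr d) (at_right (0::real))"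
      using d by (intro tendsto_powr' tendsto_intros)
        (auto simp: eventually_at_right_field intro: exI [of _ 1])
    then show "((\<lambda>x. x powr d) \<longlongrightarrow> 0) (at_right (0::real))" by simp
  qed
  moreover have "\<forall>\<^sub>F x in at_right (0::real). - (H * x powr d) \<le> g"
    unfolding eventually_at_right_field
  proof (intro exI [of _ 1] conjI allI impI)
    fix x :: real assume x: "0 < x" "x < 1"
    have "- (H * x powr (a + d)) \<le> g * x powr a"
      using F [of "1 - x"] F0 [of "1 - x"] x by simp
    then have "- (H * x powr d) * x powr a \<le> g * x powr a"
      by (simp add: powr_add algebra_simps)
    then show "- (H * x powr d) \<le> g"
      by (rule mult_right_le_imp_le) (use x in simp)
  qed simp
  ultimately show ?thesis
    using tendsto_upperbound [of "\<lambda>x. - (H * x powr d)" "- (H * 0)"] by auto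
qed

section \<open>A continuous threshold\<close>

text \<open>
  The second argument of \<open>max\<close> is the solution \<open>t\<close> of the equation
  \<open>error_coeff n v0 (a + d) \<gamma> * (2 * a + 3) * (a + 2) * t powr (- d) = \<bar>\<gamma> 0\<bar> * a / 6\<close>, at which the two
  contributions in \<open>moment_gap_lower_bound\<close> balance. The absolute value makes it meaningful also
  for \<open>\<gamma> 0 < 0\<close>, where no random variable satisfies the tail bound.
\<close>

definition threshold :: "nat \<Rightarrow> real \<Rightarrow> real \<Rightarrow> real \<Rightarrow> (nat \<Rightarrow> real) \<Rightarrow> real" where
  "threshold n v0 a d \<gamma> = max (2 * (a + 1))
     ((6 * (2 * a + 3) * (a + 2) * error_coeff n v0 (a + d) \<gamma> / (a * \<bar>\<gamma> 0\<bar>)) powr (1 / d))"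

text \<open>
  The base of the power stays positive, where a real power is continuous for every
  exponent.
\<close>

lemma continuous_map_threshold:
  assumes v0: "v0 < 1" and a: "0 < a"
  shows "continuous_map (coeff_space n) euclideanreal (threshold n v0 a d)"
proof -
  have proj [continuous_intros]: "continuous_map (coeff_space n) euclideanreal (\<lambda>\<gamma>. \<gamma> i)" for i
    unfolding coeff_space_def Euclidean_space_def
    by (intro continuous_map_from_subtopology continuous_map_product_projection) auto
  have nz: "\<gamma> 0 \<noteq> 0" if "\<gamma> \<in> topspace (coeff_space n)" for \<gamma>
    using that by (auto simp: coeff_space_def)
  let ?h = "\<lambda>\<gamma>. 6 * (2 * a + 3) * (a + 2) * error_coeff n v0 (a + d) \<gamma> / (a * \<bar>\<gamma> 0\<bar>)"
  have "continuous_map (coeff_space n) euclideanreal ?h"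
    unfolding error_coeff_def using nz v0 a by (intro continuous_intros) auto
  moreover have "?h \<gamma> \<in> {0<..}" if "\<gamma> \<in> topspace (coeff_space n)" for \<gamma>
    using nz [OF that] error_coeff_pos [OF v0, of n "a + d" \<gamma>] a by simp
  ultimately have "continuous_map (coeff_space n) (top_of_set {0<..}) ?h"
    by (auto simp: continuous_map_in_subtopology)
  moreover have "continuous_map (top_of_set {0::real<..}) euclideanreal (\<lambda>x. x powr (1 / d))"
    by (auto intro!: continuous_intros)
  ultimately have "continuous_map (coeff_space n) euclideanreal ((\<lambda>x. x powr (1 / d)) \<circ> ?h)"
    by (rule continuous_map_compose)
  then show ?thesis
    unfolding threshold_def o_def by (intro continuous_intros) 
qed

theorem proposition3p2:
  fixes n :: nat and v0 \<alpha> :: real and \<epsilon> :: "nat \<Rightarrow> real"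
  assumes "1 \<le> n"
    and "0 \<le> v0" and "v0 < 1"
    and "0 < \<alpha>"
    and "\<epsilon> 0 = 0"
    and "\<forall>i<n. \<epsilon> i < \<epsilon> (Suc i)"
    and "\<epsilon> (n - 1) \<le> 1" and "1 < \<epsilon> n"
  shows "\<exists>\<theta> :: (nat \<Rightarrow> real) \<Rightarrow> real.
           continuous_map (coeff_space n) euclideanreal \<theta> \<and>
           (\<forall>\<gamma> \<in> topspace (coeff_space n). \<forall>(M :: 'a measure) V.
              unit_random_variable M V \<and> tail_expansion n v0 \<alpha> \<epsilon> \<gamma> M V \<longrightarrow>
              (\<forall>t. 0 \<le> t \<and> \<theta> \<gamma> \<le> t \<longrightarrow> \<alpha> \<le> 2 * t * R_fun M V t))"
proof -
  define d where "d = min 1 (\<epsilon> 1)"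
  have d: "0 < d" "d \<le> 1"
    using assms(1,5,6) by (auto simp: d_def)
  have e: "d \<le> \<epsilon> i" if "1 \<le> i" "i \<le> n" for i
    using that
  proof (induction i rule: dec_induct)
    case base
    then show ?case by (simp add: d_def)
  next
    case (step i)
    then show ?case using assms(6) by (meson Suc_le_lessD less_imp_le order_trans)
  qed
  have "\<alpha> \<le> 2 * t * R_fun M V t"
    if \<gamma>: "\<gamma> \<in> topspace (coeff_space n)" and V: "unit_random_variable M V"
      and T: "tail_expansion n v0 \<alpha> \<epsilon> \<gamma> M V" and t: "threshold n v0 \<alpha> d \<gamma> \<le> t"
    for \<gamma> and M :: "'a measure" and V t
  proof -
    interpret prob_space M using V by (simp add: unit_random_variable_def)
    let ?F = "\<lambda>v. prob {\<omega> \<in> space M. v \<le> V \<omega>}" and ?H = "error_coeff n v0 (\<alpha> + d) \<gamma>"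
    let ?m = "\<lambda>s. expectation (\<lambda>\<omega>. V \<omega> powr s)"
    have F: "\<bar>?F v - \<gamma> 0 * (1 - v) powr \<alpha>\<bar> \<le> ?H * (1 - v) powr (\<alpha> + d)"
      if "0 \<le> v" "v \<le> 1" for v
      using tail_expansion_leading_term [of M n v0 \<alpha> d \<epsilon> \<gamma> V v] assms d e T that prob_space_axioms
      by blast
    have "0 \<le> \<gamma> 0"
      using d(1) F by (intro leading_coeff_nonneg [of d ?F "\<gamma> 0" \<alpha> ?H]) auto
    with \<gamma> have g: "0 < \<gamma> 0" by (auto simp: coeff_space_def)
    have H: "0 < ?H" using assms(3) by (rule error_coeff_pos)
    have t2: "2 * (\<alpha> + 1) \<le> t" using t by (simp add: threshold_def)
    then have t0: "0 < t" using assms(4) by (simp add: algebra_simps)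
    have layer: "((\<lambda>v. s * v powr (s - 1) * ?F v) has_integral ?m s) {0..1}" if "0 < s" for s
      using V that by (intro expectation_powr_eq_integral_tail) (auto simp: unit_random_variable_def)
    let ?I = "?m t - ?m (t + 1) - \<alpha> / 2 / t * ?m t"
    have "((\<lambda>v. t * v powr (t - 1) * ?F v - (t + 1) * v powr (t + 1 - 1) * ?F v
            - \<alpha> / 2 / t * (t * v powr (t - 1) * ?F v)) has_integral ?I) {0..1}"
      using t0 by (intro has_integral_diff has_integral_mult_right layer) auto
    moreover have "t * v powr (t - 1) * ?F v - (t + 1) * v powr (t + 1 - 1) * ?F v
            - \<alpha> / 2 / t * (t * v powr (t - 1) * ?F v)
        = v powr (t - 1) * ((t + 1) * (1 - v) - (\<alpha> / 2 + 1)) * ?F v" if "v \<in> {0..1}" for v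
    proof -
      have "v powr (t + 1 - 1) = v powr (t - 1) * v"
        using that t0 by (cases "v = 0") (auto simp: powr_diff)
      moreover have "\<alpha> / 2 / t * (t * v powr (t - 1) * ?F v) = \<alpha> / 2 * v powr (t - 1) * ?F v"
        using t0 by simp
      ultimately show ?thesis by (simp only:) (simp add: algebra_simps)
    qed
    ultimately have "((\<lambda>v. v powr (t - 1) * ((t + 1) * (1 - v) - (\<alpha> / 2 + 1)) * ?F v)
        has_integral ?I) {0..1}"
      by (rule has_integral_eq [rotated])
    from moment_gap_lower_bound [OF t2 assms(4) d g less_imp_le [OF H] F this]
    have "Beta t (\<alpha> + 1) * (\<gamma> 0 * \<alpha> / 6 - ?H * (2 * \<alpha> + 3) * (\<alpha> + 2) * t powr (- d)) \<le> ?I" .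
    moreover have "?H * (2 * \<alpha> + 3) * (\<alpha> + 2) * t powr (- d) \<le> \<gamma> 0 * \<alpha> / 6"
    proof -
      let ?h = "6 * (2 * \<alpha> + 3) * (\<alpha> + 2) * ?H / (\<alpha> * \<bar>\<gamma> 0\<bar>)"
      have h0: "0 < ?h" using H g assms(4) by simp
      have "?h powr (1 / d) \<le> t" using t by (simp add: threshold_def)
      with h0 d(1) have "?h \<le> t powr d" by (rule le_powr_of_root_le)
      then show ?thesis
        using g assms(4) t0 by (simp add: powr_minus field_simps)
    qed
    moreover have "0 < Beta t (\<alpha> + 1)" using t0 assms(4) by (simp add: Beta_def)
    ultimately have I0: "0 \<le> ?I"
      by (smt (verit) mult_nonneg_nonneg)
    have mom: "moment M V t = ?m t" "moment M V (t + 1) = ?m (t + 1)"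
      using t0 by (auto simp: moment_def)
    have "0 \<le> ?m t" by (intro integral_nonneg_AE) auto
    \<comment> \<open>if the moment vanishes, division by zero makes \<open>R_fun\<close> equal to \<open>1\<close>\<close>
    then consider "?m t = 0" | "0 < ?m t" by linarith
    then show ?thesis
    proof cases
      case 1
      then show ?thesis using t2 assms(4) by (simp add: R_fun_def mom)
    next
      case 2
      have "\<alpha> / 2 / t \<le> 1 - ?m (t + 1) / ?m t"
        using I0 2 by (simp add: field_simps)
      then have "\<alpha> / 2 / t \<le> R_fun M V t" by (simp only: R_fun_def mom)
      then show ?thesis using t0 by (simp add: field_simps)
    qed
  qed
  then show ?thesis
    using continuous_map_threshold [OF assms(3,4), of n d]
    by (intro exI [of _ "threshold n v0 \<alpha> d"]) blast
qed

end
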